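(* Let $G_0=\mathbb{R}^3$ with the Lorentz metric $ds_0^2=dx_0^2+2e^{x_1}dx_0\,dx_2+\frac{e^{2x_1}}{2}dx_2^2-dx_1^2$, and let $\alpha_2=\frac{\sqrt2-1}{\sqrt2+1}=(\sqrt2-1)^2$. Every isotropic geodesic $\gamma(t)=(x_0(t),x_1(t),x_2(t))$, $t\in\mathbb{R}$, of $(G_0,ds_0^2)$ starting at the unit (that is, $\gamma(0)=(0,0,0)$), future-directed and with the normalized parametrization described in the context, has the following form for some $t_0\in\mathbb{R}$: $$x_0(t)=\Big[-\tau+2\sqrt2\arctan\big((\sqrt2-1)\tan(\tau/2)\big)\Big]\Big|_{\tau=-t_0}^{\tau=t-t_0},$$ $$x_1(t)=\ln\big((1+\alpha_2)+(1-\alpha_2)\cos\tau\big)\Big|_{\tau=-t_0}^{\tau=t-t_0},$$ $$x_2(t)=\frac{\beta_2\sin\tau}{(1+\alpha_2)+(1-\alpha_2)\cos\tau}\Big|_{\tau=-t_0}^{\tau=t-t_0},\qquad \beta_2=\sqrt2\,[(1+\alpha_2)+(1-\alpha_2)\cos t_0].$$ In the case $x_1'(0)=0$ with $t_0=0$, these become $$x_0(t)=-t+2\sqrt2\arctan\big((\sqrt2-1)\tan(t/2)\big),\qquad x_1(t)=\ln\big[((1+\alpha_2)+(1-\alpha_2)\cos t)/2\big],$$ $$x_2(t)=\frac{2\sqrt2\sin t}{(1+\alpha_2)+(1-\alpha_2)\cos t}.$$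
   Context: $G_0$ is a Lie group on $\mathbb{R}^3$ with coordinates $(x_0,x_1,x_2)$, unit $(0,0,0)$, and left translations $(x_0',x_1',x_2')\mapsto(x_0'+p,\;x_1'+q,\;x_2'e^{-q}+c)$ by the element $(p,q,c)$; the metric $ds_0^2$ (signature $(+,-,-)$) is left-invariant. Isotropic means null: $ds_0^2(\gamma',\gamma')=0$, $\gamma'\ne0$. Left-invariant vector fields: $e_0=\partial_{x_0}$, $e_1=\partial_{x_1}$, $e_2=e^{-x_1}\partial_{x_2}$; $e_0,\ e_1,\ e_2'=\sqrt2(e_0-e_2)$ is an orthonormal frame. Along a geodesic the $e_0$-component of $\gamma'$ in this orthonormal frame, namely $\varphi_0=x_0'+e^{x_1}x_2'$, is constant; future-directed means $\varphi_0>0$, and the normalized parametrization of an isotropic geodesic is the affine parametrization with $\varphi_0=1$. Convention: for $\beta>0$, the expression $\arctan(\beta\tan s)$, $s\in\mathbb{R}$, denotes the continuous function of $s$ on $\mathbb{R}$ equal to the principal value on $(-\pi/2,\pi/2)$; i.e. it equals $\arctan(\beta\tan s)+k\pi$ (principal arctangent) for $|s-k\pi|<\pi/2$, and equals $\pi/2+k\pi$ at $s=\pi/2+k\pi$, $k\in\mathbb{Z}$. The notation $F(\tau)|_{\tau=A}^{\tau=B}$ means $F(B)-F(A)$. *)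

theory Defs
  imports "HOL-Analysis.Analysis"
begin

section \<open>Geodesics of a metric given in coordinates on \<open>\<real>\<^sup>n\<close>\<close>

type_synonym 'n metric = "real ^ 'n \<Rightarrow> real ^ 'n ^ 'n"

definition metric_prod :: "'n::finite metric \<Rightarrow> real ^ 'n \<Rightarrow> real ^ 'n \<Rightarrow> real ^ 'n \<Rightarrow> real" where
  "metric_prod g x v w = v \<bullet> (g x *v w)"

definition partial_deriv :: "'n::finite \<Rightarrow> (real ^ 'n \<Rightarrow> real) \<Rightarrow> real ^ 'n \<Rightarrow> real" where
  "partial_deriv k f x = deriv (\<lambda>h. f (x + h *\<^sub>R axis k 1)) 0"

definition christoffel :: "'n::finite metric \<Rightarrow> real ^ 'n \<Rightarrow> 'n \<Rightarrow> 'n \<Rightarrow> 'n \<Rightarrow> real" where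
  "christoffel g x i j k =
     (\<Sum>l\<in>UNIV. matrix_inv (g x) $ i $ l *
        (partial_deriv j (\<lambda>y. g y $ l $ k) x
         + partial_deriv k (\<lambda>y. g y $ l $ j) x
         - partial_deriv l (\<lambda>y. g y $ j $ k) x)) / 2"

definition velocity :: "(real \<Rightarrow> 'a::real_normed_vector) \<Rightarrow> real \<Rightarrow> 'a" where
  "velocity \<gamma> t = vector_derivative \<gamma> (at t)"

text \<open>Affinely parametrized geodesics of the Levi-Civita connection, defined on all of \<open>\<real>\<close>.\<close>

definition geodesic :: "'n::finite metric \<Rightarrow> (real \<Rightarrow> real ^ 'n) \<Rightarrow> bool" where
  "geodesic g \<gamma> \<longleftrightarrow>
     (\<forall>t. \<gamma> differentiable (at t)) \<and>
     (\<forall>t. velocity \<gamma> differentiable (at t)) \<and>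
     (\<forall>t i. velocity (velocity \<gamma>) t $ i
        + (\<Sum>j\<in>UNIV. \<Sum>k\<in>UNIV.
             christoffel g (\<gamma> t) i j k * velocity \<gamma> t $ j * velocity \<gamma> t $ k) = 0)"

definition isotropic :: "'n::finite metric \<Rightarrow> (real \<Rightarrow> real ^ 'n) \<Rightarrow> bool" where
  "isotropic g \<gamma> \<longleftrightarrow>
     (\<forall>t. metric_prod g (\<gamma> t) (velocity \<gamma> t) (velocity \<gamma> t) = 0 \<and> velocity \<gamma> t \<noteq> 0)"

section \<open>The Lie group \<open>G\<^sub>0\<close> and its left-invariant Lorentz metric\<close>

text \<open>The coordinates \<open>x\<^sub>0, x\<^sub>1, x\<^sub>2\<close> are the components \<open>1, 2, 3\<close> of a vector in \<open>\<real>\<^sup>3\<close>.\<close>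

definition G0_mult :: "real ^ 3 \<Rightarrow> real ^ 3 \<Rightarrow> real ^ 3" where
  "G0_mult a x = vector [x $ 1 + a $ 1, x $ 2 + a $ 2, x $ 3 * exp (- (a $ 2)) + a $ 3]"

definition G0_unit :: "real ^ 3" where
  "G0_unit = vector [0, 0, 0]"

definition G0_metric :: "3 metric" where
  "G0_metric x = vector [vector [1, 0, exp (x $ 2)],
                         vector [0, - 1, 0],
                         vector [exp (x $ 2), 0, exp (2 * x $ 2) / 2]]"

text \<open>The left-invariant orthonormal frame \<open>e\<^sub>0, e\<^sub>1, e\<^sub>2' = \<surd>2 (e\<^sub>0 - e\<^sub>2)\<close>.\<close>

definition e0 :: "real ^ 3 \<Rightarrow> real ^ 3" where "e0 x = vector [1, 0, 0]"
definition e1 :: "real ^ 3 \<Rightarrow> real ^ 3" where "e1 x = vector [0, 1, 0]"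
definition e2 :: "real ^ 3 \<Rightarrow> real ^ 3" where "e2 x = vector [0, 0, exp (- (x $ 2))]"
definition e2' :: "real ^ 3 \<Rightarrow> real ^ 3" where "e2' x = sqrt 2 *\<^sub>R (e0 x - e2 x)"

text \<open>The \<open>e\<^sub>0\<close>-component of a tangent vector \<open>v\<close> at \<open>x\<close> in this frame; see \<open>frame_decomposition\<close>.\<close>

definition phi0 :: "real ^ 3 \<Rightarrow> real ^ 3 \<Rightarrow> real" where
  "phi0 x v = v $ 1 + exp (x $ 2) * v $ 3"

definition future_directed :: "(real \<Rightarrow> real ^ 3) \<Rightarrow> bool" where
  "future_directed \<gamma> \<longleftrightarrow> (\<forall>t. phi0 (\<gamma> t) (velocity \<gamma> t) > 0)"

definition normalized :: "(real \<Rightarrow> real ^ 3) \<Rightarrow> bool" where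
  "normalized \<gamma> \<longleftrightarrow> (\<forall>t. phi0 (\<gamma> t) (velocity \<gamma> t) = 1)"

lemma metric_prod_G0:
  "metric_prod G0_metric x v w =
     v $ 1 * w $ 1 + exp (x $ 2) * (v $ 1 * w $ 3 + v $ 3 * w $ 1)
     + exp (2 * x $ 2) / 2 * (v $ 3 * w $ 3) - v $ 2 * w $ 2"
  by (simp add: metric_prod_def G0_metric_def inner_vec_def matrix_vector_mult_def sum_3
      algebra_simps)

lemma G0_mult_unit: "G0_mult G0_unit x = x" "G0_mult x G0_unit = x"
  by (simp_all add: G0_mult_def G0_unit_def vec_eq_iff forall_3)

lemma G0_mult_assoc: "G0_mult (G0_mult a b) x = G0_mult a (G0_mult b x)"
  by (simp add: G0_mult_def vec_eq_iff forall_3 algebra_simps exp_diff exp_minus field_simps exp_add)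

text \<open>The differential of the left translation by \<open>a\<close> sends \<open>v\<close> to
  \<open>(v\<^sub>0, v\<^sub>1, v\<^sub>2 exp (- a\<^sub>1))\<close>.\<close>

lemma has_derivative_G0_mult:
  "(G0_mult a has_derivative (\<lambda>v. vector [v $ 1, v $ 2, v $ 3 * exp (- (a $ 2))])) (at x)"
proof -
  have "\<forall>i. ((\<lambda>y. G0_mult a y $ i) has_derivative
            (\<lambda>v. vector [v $ 1, v $ 2, v $ 3 * exp (- (a $ 2))] $ i)) (at x)"
    unfolding forall_3 G0_mult_def vector_3 by (auto intro!: derivative_eq_intros bounded_linear_imp_has_derivative)
  thus ?thesis
    by (auto simp: has_derivative_componentwise_within[of "G0_mult a"] Basis_vec_def inner_axis)
qed

lemma G0_metric_left_invariant:
  "metric_prod G0_metric (G0_mult a x)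
     (vector [v $ 1, v $ 2, v $ 3 * exp (- (a $ 2))]) (vector [w $ 1, w $ 2, w $ 3 * exp (- (a $ 2))])
   = metric_prod G0_metric x v w"
  by (simp add: metric_prod_G0 G0_mult_def exp_minus exp_add exp_double field_simps power2_eq_square)

lemma orthonormal_frame:
  "metric_prod G0_metric x (e0 x) (e0 x) = 1"
  "metric_prod G0_metric x (e1 x) (e1 x) = - 1"
  "metric_prod G0_metric x (e2' x) (e2' x) = - 1"
  "metric_prod G0_metric x (e0 x) (e1 x) = 0"
  "metric_prod G0_metric x (e0 x) (e2' x) = 0"
  "metric_prod G0_metric x (e1 x) (e2' x) = 0"
  by (simp_all add: metric_prod_G0 e0_def e1_def e2_def e2'_def algebra_simps exp_minus exp_double
      power2_eq_square)

lemma frame_decomposition: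
  "v = phi0 x v *\<^sub>R e0 x + v $ 2 *\<^sub>R e1 x + (- exp (x $ 2) * v $ 3 / sqrt 2) *\<^sub>R e2' x"
  by (simp add: vec_eq_iff forall_3 phi0_def e0_def e1_def e2_def e2'_def exp_minus)

section \<open>The explicit curves\<close>

text \<open>The continuous branch on \<open>\<real>\<close> of \<open>arctan (\<beta> tan s)\<close>.  At the poles of \<open>tan\<close>, where
  \<open>cos s = 0\<close>, its value is \<open>s\<close> itself; see the two lemmas that follow.\<close>

definition arctan_tan :: "real \<Rightarrow> real \<Rightarrow> real" where
  "arctan_tan \<beta> s =
     (if cos s = 0 then s else arctan (\<beta> * tan s) + of_int (round (s / pi)) * pi)"

lemma arctan_tan_branch:
  assumes "\<bar>s - of_int k * pi\<bar> < pi / 2"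
  shows "arctan_tan \<beta> s = arctan (\<beta> * tan s) + of_int k * pi"
proof -
  have "cos (s - of_int k * pi) > 0"
    using assms unfolding abs_less_iff by (intro cos_gt_zero_pi; linarith)
  hence "cos s \<noteq> 0"
    by (auto simp: cos_diff mult.commute[of _ pi])
  moreover have "\<bar>s / pi - of_int k\<bar> < 1 / 2"
  proof -
    have "\<bar>s / pi - of_int k\<bar> = \<bar>s - of_int k * pi\<bar> / pi"
      by (simp add: abs_if field_simps)
    also have "\<dots> < (pi / 2) / pi"
      using assms by (intro divide_strict_right_mono) auto
    finally show ?thesis by simp
  qed
  hence "round (s / pi) = k"
    by (intro round_unique') auto
  ultimately show ?thesis by (simp add: arctan_tan_def)
qed

lemma arctan_tan_pole: "arctan_tan \<beta> (pi / 2 + of_int k * pi) = pi / 2 + of_int k * pi"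
  by (simp add: arctan_tan_def cos_add sin_zero_iff_int2)

definition eval_between :: "(real \<Rightarrow> real) \<Rightarrow> real \<Rightarrow> real \<Rightarrow> real" where
  "eval_between F A B = F B - F A"

definition \<alpha>\<^sub>2 :: real where
  "\<alpha>\<^sub>2 = (sqrt 2 - 1) / (sqrt 2 + 1)"

definition \<beta>\<^sub>2 :: "real \<Rightarrow> real" where
  "\<beta>\<^sub>2 t0 = sqrt 2 * ((1 + \<alpha>\<^sub>2) + (1 - \<alpha>\<^sub>2) * cos t0)"

lemma \<alpha>\<^sub>2_eq: "\<alpha>\<^sub>2 = (sqrt 2 - 1)\<^sup>2"
proof -
  have "(sqrt 2 - 1) * (sqrt 2 + 1) = (1::real)" and "sqrt 2 + 1 \<noteq> (0::real)"
    by (simp_all add: algebra_simps add_nonneg_eq_0_iff)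
  thus ?thesis
    by (simp add: \<alpha>\<^sub>2_def power2_eq_square divide_eq_eq mult.assoc)
qed

definition null_curve :: "real \<Rightarrow> real \<Rightarrow> real ^ 3" where
  "null_curve t0 t = vector
     [eval_between (\<lambda>\<tau>. - \<tau> + 2 * sqrt 2 * arctan_tan (sqrt 2 - 1) (\<tau> / 2)) (- t0) (t - t0),
      eval_between (\<lambda>\<tau>. ln ((1 + \<alpha>\<^sub>2) + (1 - \<alpha>\<^sub>2) * cos \<tau>)) (- t0) (t - t0),
      eval_between (\<lambda>\<tau>. \<beta>\<^sub>2 t0 * sin \<tau> / ((1 + \<alpha>\<^sub>2) + (1 - \<alpha>\<^sub>2) * cos \<tau>)) (- t0) (t - t0)]"

end

theory Submission
  imports Defs
begin

text \<open>The momentum \<open>c = e\<^bsup>x\<^sub>1\<^esup> x\<^sub>0' + e\<^bsup>2 x\<^sub>1\<^esup> x\<^sub>2' / 2\<close> conjugate to the cyclic coordinate \<open>x\<^sub>2\<close>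
  is conserved.  With \<open>\<phi>\<^sub>0 = 1\<close> it expresses \<open>x\<^sub>0'\<close> and \<open>x\<^sub>2'\<close> through \<open>y = e\<^bsup>x\<^sub>1\<^esup>\<close>, and the
  remaining geodesic equation together with isotropy becomes the linear equation \<open>y'' + y = 2 c\<close>.
  Isotropy at \<open>t = 0\<close> makes the amplitude of its solution equal to \<open>\<surd>2 c\<close>, hence
  \<open>y = c (2 + \<surd>2 cos (t - t\<^sub>0))\<close>; the other two coordinates follow by quadrature.\<close>

section \<open>The continuous branch of \<open>arctan (\<beta> tan s)\<close>\<close>

text \<open>The subtraction formula for \<open>arctan\<close> gives an expression without case distinction, smooth
  also at the poles of \<open>tan\<close>.\<close>

lemma arctan_tan_eq:
  assumes "b > 0"
  shows "arctan_tan b s = s - arctan ((1 - b) * (sin s * cos s) / ((cos s)\<^sup>2 + b * (sin s)\<^sup>2))"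
proof (cases "cos s = 0")
  case True
  then show ?thesis by (simp add: arctan_tan_def)
next
  case False
  define k where "k = round (s / pi)"
  define r where "r = s - of_int k * pi"
  have s: "s = r + of_int k * pi" by (simp add: r_def)
  have sin0: "sin (of_int k * pi) = 0"
    unfolding sin_zero_iff_int2 by blast
  \<comment> \<open>Here e = cos(k pi) is the sign 1 or -1. Only its square matters, because the
    final formula is quadratic in sin and cos and hence has period pi.\<close>
  obtain e where e: "sin s = e * sin r" "cos s = e * cos r" "e * e = (1::real)"
  proof
    show "sin s = cos (of_int k * pi) * sin r" "cos s = cos (of_int k * pi) * cos r"
      by (simp_all add: s sin_add cos_add sin0)
    show "cos (of_int k * pi) * cos (of_int k * pi) = (1::real)"
      using sin_cos_squared_add3[of "of_int k * pi"] sin0 by simp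
  qed
  have "\<bar>s / pi - of_int k\<bar> \<le> 1 / 2"
    unfolding k_def using of_int_round_abs_le[of "s / pi"] by (simp add: abs_minus_commute)
  moreover have "r = (s / pi - of_int k) * pi"
    by (simp add: r_def field_simps)
  ultimately have "\<bar>r\<bar> \<le> (1 / 2) * pi"
    by (simp add: abs_mult mult_right_mono)
  \<comment> \<open>Rounding leaves the closed bound pi / 2; ties occur only at the poles of tan,
    which \<open>False\<close> excludes.\<close>
  moreover have "\<bar>r\<bar> \<noteq> pi / 2"
  proof
    assume "\<bar>r\<bar> = pi / 2"
    then have "r = pi / 2 \<or> r = - (pi / 2)" by linarith
    then have "cos r = 0" by (elim disjE) (simp_all only: cos_minus cos_pi_half)
    with False show False by (simp add: s cos_add sin0)
  qed
  ultimately have r: "\<bar>r\<bar> < pi / 2" by simp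
  define t where "t = tan r"
  have cr: "cos r > 0"
    using r by (intro cos_gt_zero_pi) auto
  have ar: "arctan t = r"
    unfolding t_def using r by (intro arctan_tan) auto
  have branch: "arctan_tan b s = arctan (b * t) + of_int k * pi"
  proof -
    have "tan s = t"
      using e by (auto simp: t_def tan_def)
    then show ?thesis
      using r arctan_tan_branch[of s k b] by (simp add: r_def)
  qed
  \<comment> \<open>Since b > 0, t and b * t have the same sign, so both arctangents lie on the same
    side of 0. The subtraction formula therefore needs no correction by a multiple of pi.\<close>
  have bd: "\<bar>arctan t - arctan (b * t)\<bar> < pi / 2"
  proof (cases "t \<ge> 0")
    case True
    then have "arctan t \<ge> 0" "arctan (b * t) \<ge> 0" using assms by simp_all
    then show ?thesis using arctan_ubound[of t] arctan_ubound[of "b * t"] by linarith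
  next
    case False
    then have "arctan t \<le> 0" "arctan (b * t) \<le> 0" using assms by (simp_all add: mult_le_0_iff)
    then show ?thesis using arctan_lbound[of t] arctan_lbound[of "b * t"] by linarith
  qed
  have "cos (arctan t - arctan (b * t)) \<noteq> 0"
    using bd cos_gt_zero_pi[of "arctan t - arctan (b * t)"] by linarith
  then have "tan (arctan t - arctan (b * t)) = (t - b * t) / (1 + t * (b * t))"
    by (subst tan_diff) (simp_all add: tan_arctan)
  then have "arctan t - arctan (b * t) = arctan ((t - b * t) / (1 + t * (b * t)))"
    using bd by (metis arctan_tan abs_less_iff minus_less_iff)
  also have "(t - b * t) / (1 + t * (b * t))
      = (1 - b) * (sin r * cos r) / ((cos r)\<^sup>2 + b * (sin r)\<^sup>2)"
  proof -
    have "1 + t * (b * t) = ((cos r)\<^sup>2 + b * (sin r)\<^sup>2) / (cos r)\<^sup>2"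
      using cr by (simp add: t_def tan_def field_simps power2_eq_square)
    moreover have "t - b * t = (1 - b) * (sin r * cos r) / (cos r)\<^sup>2"
      using cr by (simp add: t_def tan_def field_simps power2_eq_square)
    ultimately show ?thesis using cr by simp
  qed
  finally have "r - arctan (b * t) =
      arctan ((1 - b) * (sin r * cos r) / ((cos r)\<^sup>2 + b * (sin r)\<^sup>2))"
    by (simp add: ar)
  moreover have "sin r * cos r = sin s * cos s" "(cos r)\<^sup>2 = (cos s)\<^sup>2" "(sin r)\<^sup>2 = (sin s)\<^sup>2"
    using e(3) unfolding e(1,2) by algebra+
  ultimately show ?thesis
    by (simp add: branch r_def)
qed

text \<open>Differentiating the closed form of \<open>arctan_tan_eq\<close> treats the poles of tan
  like all other points, so no gluing of branches is required.\<close>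

lemma arctan_tan_has_real_derivative:
  assumes "b > 0"
  shows "(arctan_tan b has_real_derivative b / ((cos s)\<^sup>2 + b\<^sup>2 * (sin s)\<^sup>2)) (at s)"
proof -
  define S C where "S = sin s" and "C = cos s"
  have SC: "C\<^sup>2 + S\<^sup>2 = 1" by (simp add: S_def C_def)
  define M N where "M = C\<^sup>2 + b * S\<^sup>2" and "N = (1 - b) * (S * C)"
  have pos: "x * C\<^sup>2 + y * S\<^sup>2 > 0" if "x > 0" "y > 0" for x y :: real
  proof (cases "S = 0")
    case True
    then show ?thesis using SC that by simp
  next
    case False
    then show ?thesis using that by (intro add_nonneg_pos) auto
  qed
  have M: "M > 0" using pos[of 1 b] assms by (simp add: M_def)
  have P: "C\<^sup>2 + b\<^sup>2 * S\<^sup>2 > 0" using pos[of 1 "b\<^sup>2"] assms by simp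
  have MN: "M\<^sup>2 + N\<^sup>2 = C\<^sup>2 + b\<^sup>2 * S\<^sup>2"
  proof -
    have "M\<^sup>2 + N\<^sup>2 = (C\<^sup>2 + S\<^sup>2) * (C\<^sup>2 + b\<^sup>2 * S\<^sup>2)"
      by (simp add: M_def N_def) algebra
    then show ?thesis by (simp add: SC)
  qed
  \<comment> \<open>The derivatives of N and M with respect to s.\<close>
  define N' M' where "N' = (1 - b) * (C\<^sup>2 - S\<^sup>2)" and "M' = 2 * (b - 1) * (S * C)"
  have "((\<lambda>s. s - arctan ((1 - b) * (sin s * cos s) / ((cos s)\<^sup>2 + b * (sin s)\<^sup>2)))
      has_real_derivative 1 - (N' * M - N * M') / M\<^sup>2 / (1 + (N / M)\<^sup>2)) (at s)"
    using M unfolding M_def N_def N'_def M'_def S_def C_def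
    by (auto intro!: derivative_eq_intros simp: power2_eq_square field_simps)
  moreover have "1 - (N' * M - N * M') / M\<^sup>2 / (1 + (N / M)\<^sup>2) = b / (C\<^sup>2 + b\<^sup>2 * S\<^sup>2)"
  proof -
    have "(N' * M - N * M') / M\<^sup>2 / (1 + (N / M)\<^sup>2) = (N' * M - N * M') / (M\<^sup>2 + N\<^sup>2)"
    proof -
      have "M\<^sup>2 * (1 + (N / M)\<^sup>2) = M\<^sup>2 + N\<^sup>2"
        using M by (simp add: power_divide distrib_left)
      then show ?thesis by simp
    qed
    moreover have "C\<^sup>2 + b\<^sup>2 * S\<^sup>2 - (N' * M - N * M') = b"
    proof -
      have C2: "C\<^sup>2 = 1 - S\<^sup>2" using SC by simp
      have "N' * M - N * M' = (1 - b) * ((C\<^sup>2 - S\<^sup>2) * (C\<^sup>2 + b * S\<^sup>2) + 2 * (1 - b) * S\<^sup>2 * C\<^sup>2)"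
        unfolding N'_def N_def M'_def M_def by algebra
      then show ?thesis unfolding C2 by algebra
    qed
    moreover have "1 - n / d = (d - n) / d" if "d > 0" for n d :: real
      using that by (simp add: field_simps)
    ultimately show ?thesis using P by (simp only: MN)
  qed
  ultimately show ?thesis
    unfolding S_def C_def arctan_tan_eq[OF assms, abs_def] by simp
qed

section \<open>The geodesic equations of \<open>G\<^sub>0\<close>\<close>

lemma partial_deriv_nth:
  fixes \<phi> :: "real \<Rightarrow> real"
  assumes "(\<phi> has_real_derivative D) (at (x $ i))"
  shows "partial_deriv k (\<lambda>y. \<phi> (y $ i)) x = (if k = i then D else 0)"
proof (cases "k = i")
  case True
  have "((\<lambda>h. \<phi> (x $ i + h)) has_real_derivative D) (at 0)"
    using assms DERIV_shift[of \<phi> D 0 "x $ i"] by (simp add: add.commute)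
  then show ?thesis
    using True by (simp add: partial_deriv_def axis_def DERIV_imp_deriv)
next
  case False
  then show ?thesis
    by (simp add: partial_deriv_def axis_def)
qed

lemma partial_deriv_const: "partial_deriv k (\<lambda>y. c) x = 0"
  by (simp add: partial_deriv_def)

text \<open>\<open>matrix_inv\<close> is defined by choice; B witnesses that an inverse exists, and
  uniqueness of two-sided inverses identifies the chosen one with B.\<close>

lemma matrix_inv_unique:
  fixes A B :: "real ^ 'n ^ 'n"
  assumes "A ** B = mat 1" "B ** A = mat 1"
  shows "matrix_inv A = B"
proof -
  have "A ** matrix_inv A = mat 1"
    unfolding matrix_inv_def using someI[of "\<lambda>A'. A ** A' = mat 1 \<and> A' ** A = mat 1" B] assms
    by blast
  then have "B ** (A ** matrix_inv A) = B" by simp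
  then show ?thesis using assms(2) by (simp add: matrix_mul_assoc)
qed

lemma matrix_inv_G0_metric:
  "matrix_inv (G0_metric x) =
     vector [vector [- 1, 0, 2 / exp (x $ 2)],
             vector [0, - 1, 0],
             vector [2 / exp (x $ 2), 0, - 2 / exp (2 * x $ 2)]]"
  by (rule matrix_inv_unique)
    (simp_all add: G0_metric_def vec_eq_iff forall_3 matrix_matrix_mult_def sum_3 mat_def
      exp_double field_simps power2_eq_square)

lemma partial_deriv_G0_metric:
  "partial_deriv k (\<lambda>y. G0_metric y $ i $ j) x =
     (if k = 2 then (vector [vector [0, 0, exp (x $ 2)], vector [0, 0, 0],
        vector [exp (x $ 2), 0, exp (2 * x $ 2)]] :: real ^ 3 ^ 3) $ i $ j else 0)"
proof -
  have "partial_deriv k (\<lambda>y. exp (y $ 2)) x = (if k = 2 then exp (x $ 2) else 0)"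
    by (rule partial_deriv_nth) (auto intro!: derivative_eq_intros)
  moreover have "partial_deriv k (\<lambda>y. exp (2 * y $ 2) / 2) x = (if k = 2 then exp (2 * x $ 2) else 0)"
    by (rule partial_deriv_nth[where \<phi> = "\<lambda>z. exp (2 * z) / 2"]) (auto intro!: derivative_eq_intros)
  ultimately show ?thesis
    using exhaust_3[of i] exhaust_3[of j] unfolding G0_metric_def
    by (elim disjE) (simp_all add: partial_deriv_const)
qed

text \<open>The equations for x_1 and x_2, which have indices 2 and 3. The velocity x_0' is later
  eliminated by the normalization.\<close>

lemma geodesic_G0_metric:
  assumes "geodesic G0_metric \<gamma>"
  shows "velocity (velocity \<gamma>) t $ 2 =
      - (exp (\<gamma> t $ 2) * velocity \<gamma> t $ 1 * velocity \<gamma> t $ 3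
         + exp (2 * \<gamma> t $ 2) / 2 * (velocity \<gamma> t $ 3)\<^sup>2)"
    and "velocity (velocity \<gamma>) t $ 3 =
      2 * velocity \<gamma> t $ 1 * velocity \<gamma> t $ 2 / exp (\<gamma> t $ 2)"
proof -
  have "\<forall>i. velocity (velocity \<gamma>) t $ i
        + (\<Sum>j\<in>UNIV. \<Sum>k\<in>UNIV.
             christoffel G0_metric (\<gamma> t) i j k * velocity \<gamma> t $ j * velocity \<gamma> t $ k) = 0"
    using assms unfolding geodesic_def by blast
  then show "velocity (velocity \<gamma>) t $ 2 =
      - (exp (\<gamma> t $ 2) * velocity \<gamma> t $ 1 * velocity \<gamma> t $ 3
         + exp (2 * \<gamma> t $ 2) / 2 * (velocity \<gamma> t $ 3)\<^sup>2)"
    and "velocity (velocity \<gamma>) t $ 3 =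
      2 * velocity \<gamma> t $ 1 * velocity \<gamma> t $ 2 / exp (\<gamma> t $ 2)"
    unfolding forall_3 sum_3 christoffel_def matrix_inv_G0_metric partial_deriv_G0_metric
    by (simp_all add: exp_double power2_eq_square field_simps)
qed

lemma has_real_derivative_velocity_nth:
  assumes "\<gamma> differentiable (at t)"
  shows "((\<lambda>t. \<gamma> t $ i) has_real_derivative velocity \<gamma> t $ i) (at t)"
proof -
  have "(\<gamma> has_vector_derivative velocity \<gamma> t) (at t)"
    using assms by (simp add: velocity_def vector_derivative_works)
  from bounded_linear.has_vector_derivative[OF bounded_linear_vec_nth this]
  show ?thesis by (simp add: has_real_derivative_iff_has_vector_derivative)
qed

section \<open>Integration\<close>

lemma eq_if_same_derivative:
  fixes f g :: "real \<Rightarrow> real"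
  assumes "\<And>t. (f has_real_derivative h t) (at t)" "\<And>t. (g has_real_derivative h t) (at t)"
    and "f a = g a"
  shows "f t = g t"
proof -
  have "((\<lambda>t. f t - g t) has_real_derivative 0) (at t)" for t
    using DERIV_diff[OF assms(1) assms(2)] by simp
  then have "f t - g t = f a - g a"
    using DERIV_isconst_all[of "\<lambda>t. f t - g t"] by blast
  then show ?thesis using assms(3) by simp
qed

text \<open>The flow in the phase plane of (z, z') is a rotation. Undoing it gives two constants of
  motion, from which z is recovered.\<close>

lemma harmonic_oscillator:
  fixes z z' :: "real \<Rightarrow> real"
  assumes z: "\<And>t. (z has_real_derivative z' t) (at t)"
    and z': "\<And>t. (z' has_real_derivative - z t) (at t)"
  shows "z t = z 0 * cos t + z' 0 * sin t"
proof -
  have "((\<lambda>t. z t * cos t - z' t * sin t) has_real_derivative 0) (at t)" for t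
    by (auto intro!: derivative_eq_intros z z')
  then have 1: "z t * cos t - z' t * sin t = z 0"
    using DERIV_isconst_all[of "\<lambda>t. z t * cos t - z' t * sin t" t 0] by simp
  have "((\<lambda>t. z t * sin t + z' t * cos t) has_real_derivative 0) (at t)" for t
    by (auto intro!: derivative_eq_intros z z')
  then have 2: "z t * sin t + z' t * cos t = z' 0"
    using DERIV_isconst_all[of "\<lambda>t. z t * sin t + z' t * cos t" t 0] by simp
  have "z t * ((sin t)\<^sup>2 + (cos t)\<^sup>2) = z 0 * cos t + z' 0 * sin t"
    unfolding 1[symmetric] 2[symmetric] by algebra
  then show ?thesis by simp
qed

text \<open>With \<open>\<alpha>\<^sub>2\<close> = 3 - 2 sqrt 2, the denominator is a constant
  multiple of 2 + sqrt 2 cos t, the profile of exp(x_1). The factor 2 - sqrt 2 cancels in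
  differences of logarithms and against \<open>\<beta>\<^sub>2\<close>.\<close>

lemma null_curve_denominator:
  "(1 + \<alpha>\<^sub>2) + (1 - \<alpha>\<^sub>2) * x = (2 - sqrt 2) * (2 + sqrt 2 * x)"
  by (simp add: \<alpha>\<^sub>2_eq power2_eq_square algebra_simps)

lemma two_plus_sqrt2_cos_pos: "2 + sqrt 2 * cos s > (0::real)"
proof -
  have "sqrt 2 * cos s \<ge> sqrt 2 * (- 1)" by (intro mult_left_mono) auto
  moreover have "sqrt 2 < (2::real)" by (rule real_less_lsqrt) auto
  ultimately show ?thesis by linarith
qed

text \<open>For b = sqrt 2 - 1 the half-angle formulas turn the denominator in the derivative of
  \<open>arctan_tan\<close> into a multiple of 2 + sqrt 2 cos t. This supplies the antiderivative
  for x_0.\<close>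

lemma arctan_tan_half_has_real_derivative:
  "((\<lambda>t. - t + 2 * sqrt 2 * arctan_tan (sqrt 2 - 1) (t / 2))
     has_real_derivative - 1 + 2 / (2 + sqrt 2 * cos t)) (at t)"
proof -
  have *: "(cos (t / 2))\<^sup>2 + (sqrt 2 - 1)\<^sup>2 * (sin (t / 2))\<^sup>2 = (sqrt 2 - 1) * sqrt 2 * (2 + sqrt 2 * cos t) / 2"
  proof -
    define c where "c = (cos (t / 2))\<^sup>2"
    have sin: "(sin (t / 2))\<^sup>2 = 1 - c" by (simp add: sin_squared_eq c_def)
    have cos: "cos t = 2 * c - 1" using cos_double_cos[of "t / 2"] by (simp add: c_def)
    show ?thesis
      unfolding sin cos c_def[symmetric] by (simp add: power2_eq_square field_simps)
  qed
  have deriv: "((\<lambda>t. - t + 2 * sqrt 2 * arctan_tan (sqrt 2 - 1) (t / 2)) has_real_derivative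
      - 1 + 2 * sqrt 2 * ((sqrt 2 - 1) / ((sqrt 2 - 1) * sqrt 2 * (2 + sqrt 2 * cos t) / 2) * (1 / 2)))
      (at t)"
    unfolding *[symmetric]
    by (intro DERIV_add DERIV_minus DERIV_cmult DERIV_ident
        DERIV_chain2[OF arctan_tan_has_real_derivative] DERIV_cdivide) simp
  have cancel: "2 * q * (d / (d * q * e / 2) * (1 / 2)) = 2 / e" if "d \<noteq> 0" "q \<noteq> 0"
    for d q e :: real
    using that by simp
  have "2 * sqrt 2 * ((sqrt 2 - 1) / ((sqrt 2 - 1) * sqrt 2 * e / 2) * (1 / 2)) = 2 / e"
    for e :: real
    by (rule cancel) simp_all
  with deriv show ?thesis by (simp only:)
qed

lemma null_curve_third_has_real_derivative:
  "((\<lambda>t. sin t / (2 + sqrt 2 * cos t)) has_real_derivative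
     (2 * cos t + sqrt 2) / (2 + sqrt 2 * cos t)\<^sup>2) (at t)"
proof -
  have "cos t * (2 + sqrt 2 * cos t) + sin t * (sqrt 2 * sin t)
      = 2 * cos t + sqrt 2"
    using sin_cos_squared_add[of t] by algebra
  then show ?thesis
    using two_plus_sqrt2_cos_pos[of t]
    by (auto intro!: derivative_eq_intros simp: power2_eq_square mult.commute[of "sin t" "sqrt 2"])
qed

section \<open>Solution of the geodesic equations\<close>

lemma isotropic_geodesic_is_null_curve:
  assumes geo: "geodesic G0_metric \<gamma>"
    and iso: "isotropic G0_metric \<gamma>"
    and unit: "\<gamma> 0 = G0_unit"
    and norm: "normalized \<gamma>"
  shows "\<exists>t0. \<forall>t. \<gamma> t = null_curve t0 t"
proof -
  define v where "v = velocity \<gamma>"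
  define y where "y = (\<lambda>t. exp (\<gamma> t $ 2))"
  have y_pos: "y t > 0" for t by (simp add: y_def)
  have d\<gamma>: "((\<lambda>t. \<gamma> t $ i) has_real_derivative v t $ i) (at t)" for t i
    using geo unfolding v_def geodesic_def by (intro has_real_derivative_velocity_nth) blast
  have dv: "((\<lambda>t. v t $ i) has_real_derivative velocity v t $ i) (at t)" for t i
    using geo unfolding v_def geodesic_def by (intro has_real_derivative_velocity_nth) blast
  have v1: "v t $ 1 = 1 - y t * v t $ 3" for t
    using norm by (simp add: normalized_def phi0_def v_def y_def algebra_simps eq_diff_eq)
  \<comment> \<open>In the orthonormal frame the velocity has components 1, x_1' and -y x_2' / sqrt
    2, so isotropy says that the squares of the last two sum to 1.\<close>
  have v2: "(v t $ 2)\<^sup>2 = 1 - (y t * v t $ 3)\<^sup>2 / 2" for t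
  proof -
    have "metric_prod G0_metric (\<gamma> t) (v t) (v t) = 0"
      using iso by (simp add: isotropic_def v_def)
    then have "(v t $ 1)\<^sup>2 + y t * (2 * v t $ 1 * v t $ 3) + (y t)\<^sup>2 / 2 * (v t $ 3)\<^sup>2 = (v t $ 2)\<^sup>2"
      by (simp add: metric_prod_G0 y_def exp_double power2_eq_square algebra_simps)
    then show ?thesis unfolding v1 by (simp add: power2_eq_square algebra_simps)
  qed
  have a2: "velocity v t $ 2 = - (y t * v t $ 3) + (y t * v t $ 3)\<^sup>2 / 2" for t
  proof -
    have "velocity v t $ 2 = - (y t * v t $ 1 * v t $ 3 + (y t)\<^sup>2 / 2 * (v t $ 3)\<^sup>2)"
      using geodesic_G0_metric(1)[OF geo] by (simp add: v_def y_def exp_double)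
    then show ?thesis unfolding v1 by (simp add: power2_eq_square algebra_simps)
  qed
  have a3: "velocity v t $ 3 = 2 * v t $ 1 * v t $ 2 / y t" for t
    using geodesic_G0_metric(2)[OF geo] by (simp add: v_def y_def)
  have dy: "(y has_real_derivative y t * v t $ 2) (at t)" for t
    unfolding y_def by (auto intro!: derivative_eq_intros d\<gamma>)

  \<comment> \<open>The conserved momentum becomes y - y^2 x_2' / 2 once x_0' is eliminated; c is
    its value at t = 0, where y = 1.\<close>
  define c where "c = 1 - v 0 $ 3 / 2"
  have y0: "y 0 = 1" and x0: "\<gamma> 0 $ i = 0" for i
    using unit exhaust_3[of i] by (auto simp: y_def G0_unit_def)
  have momentum: "y t - (y t)\<^sup>2 * v t $ 3 / 2 = c" for t
  proof -
    have "((\<lambda>t. y t - (y t)\<^sup>2 * v t $ 3 / 2) has_real_derivative 0) (at t)" for t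
      using y_pos[of t]
      by (auto intro!: derivative_eq_intros dy dv simp: a3 v1 power2_eq_square field_simps)
    then have "y t - (y t)\<^sup>2 * v t $ 3 / 2 = y 0 - (y 0)\<^sup>2 * v 0 $ 3 / 2"
      using DERIV_isconst_all[of "\<lambda>t. y t - (y t)\<^sup>2 * v t $ 3 / 2"] by blast
    then show ?thesis by (simp add: y0 c_def)
  qed
  have v3: "v t $ 3 = 2 * (y t - c) / (y t)\<^sup>2" for t
    using momentum[of t] y_pos[of t] by (simp add: field_simps)

  have "y t - 2 * c = (y 0 - 2 * c) * cos t + (y 0 * v 0 $ 2) * sin t" for t
  proof (rule harmonic_oscillator[of "\<lambda>t. y t - 2 * c" "\<lambda>t. y t * v t $ 2"])
    show "((\<lambda>t. y t - 2 * c) has_real_derivative y t * v t $ 2) (at t)" for t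
      by (auto intro!: derivative_eq_intros dy)
    have "y t * v t $ 2 * v t $ 2 + velocity v t $ 2 * y t = - (y t - 2 * c)" for t
    proof -
      have "y t * v t $ 2 * v t $ 2 + velocity v t $ 2 * y t
          = y t * ((v t $ 2)\<^sup>2 + velocity v t $ 2)"
        by (simp add: power2_eq_square algebra_simps)
      \<comment> \<open>The quadratic terms from isotropy and from the equation for x_1'' cancel,
        which is why the equation for y is linear.\<close>
      also have "(v t $ 2)\<^sup>2 + velocity v t $ 2 = 1 - y t * v t $ 3"
        using v2[of t] a2[of t] by simp
      also have "y t * (1 - y t * v t $ 3) = y t - (y t)\<^sup>2 * v t $ 3"
        by (simp add: power2_eq_square algebra_simps)
      finally show ?thesis using momentum[of t] by simp
    qed
    then show "((\<lambda>t. y t * v t $ 2) has_real_derivative - (y t - 2 * c)) (at t)" for t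
      by (auto intro!: derivative_eq_intros dy dv simp: algebra_simps)
  qed
  then have y_eq: "y t = 2 * c + (1 - 2 * c) * cos t + v 0 $ 2 * sin t" for t
    by (simp add: y0 algebra_simps)

  have w: "v 0 $ 3 = 2 - 2 * c" by (simp add: c_def)
  have amplitude: "(1 - 2 * c)\<^sup>2 + (v 0 $ 2)\<^sup>2 = (sqrt 2 * c)\<^sup>2"
    using v2[of 0] by (simp add: w y0 power2_eq_square field_simps)
  \<comment> \<open>For c \<le> 0 one has x_2'(0) \<ge> 2, and isotropy would give x_1'(0)^2 \<le>
    -1.\<close>
  have c_pos: "c > 0"
  proof (rule ccontr)
    assume "\<not> c > 0"
    then have "(2 - 2 * c)\<^sup>2 \<ge> 2\<^sup>2" by (intro power_mono) auto
    then show False using v2[of 0] zero_le_power2[of "v 0 $ 2"] by (simp add: w y0)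
  qed
  \<comment> \<open>t0 is the polar angle of the point (1 - 2 c, x_1'(0)) on the circle of radius
    sqrt 2 c.\<close>
  obtain t0 where t0: "1 - 2 * c = sqrt 2 * c * cos t0" "v 0 $ 2 = sqrt 2 * c * sin t0"
  proof -
    have "((1 - 2 * c) / (sqrt 2 * c))\<^sup>2 + (v 0 $ 2 / (sqrt 2 * c))\<^sup>2 = 1"
      using amplitude c_pos by (simp add: power_divide flip: add_divide_distrib)
    from sincos_total_2pi[OF this] obtain t0
      where "(1 - 2 * c) / (sqrt 2 * c) = cos t0" "v 0 $ 2 / (sqrt 2 * c) = sin t0" by blast
    then show ?thesis using that[of t0] c_pos by (simp add: field_simps)
  qed
  define E where "E = (\<lambda>t. 2 + sqrt 2 * cos t)"
  have E_pos: "E t > 0" for t by (simp add: E_def two_plus_sqrt2_cos_pos)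
  have y_E: "y t = c * E (t - t0)" for t
    unfolding y_eq t0 by (simp add: E_def cos_diff algebra_simps)
  \<comment> \<open>This is y(0) = 1. It replaces 1 / c by E t0, the origin of the factor depending
    on t0 in \<open>\<beta>\<^sub>2\<close>.\<close>
  have c_E: "c * E t0 = 1"
    using t0(1) by (simp add: E_def algebra_simps)
  have x1: "\<gamma> t $ 1 = null_curve t0 t $ 1" for t
  proof (rule eq_if_same_derivative[where a = 0 and f = "\<lambda>t. \<gamma> t $ 1"
        and g = "\<lambda>t. null_curve t0 t $ 1" and h = "\<lambda>t. - 1 + 2 / E (t - t0)"])
    fix t
    \<comment> \<open>Substituting x_2' = 2 (y - c) / y^2 in 1 - y x_2' leaves -1 + 2 c / y.\<close>
    have "v t $ 1 = - 1 + 2 / E (t - t0)"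
      using y_pos[of t] c_pos E_pos[of "t - t0"]
      by (simp add: v1 v3 y_E field_simps power2_eq_square)
    then show "((\<lambda>t. \<gamma> t $ 1) has_real_derivative - 1 + 2 / E (t - t0)) (at t)"
      using d\<gamma>[where i = 1 and t = t] by simp
    have "((\<lambda>t. - (t - t0) + 2 * sqrt 2 * arctan_tan (sqrt 2 - 1) ((t - t0) / 2))
        has_real_derivative (- 1 + 2 / E (t - t0)) * 1) (at t)"
      unfolding E_def
      by (rule DERIV_chain2[OF arctan_tan_half_has_real_derivative])
        (auto intro!: derivative_eq_intros)
    then show "((\<lambda>t. null_curve t0 t $ 1) has_real_derivative - 1 + 2 / E (t - t0)) (at t)"
      unfolding null_curve_def eval_between_def vector_3
      by (rule DERIV_cong[OF DERIV_diff[OF _ DERIV_const]]) simp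
  qed (simp add: x0 null_curve_def eval_between_def)
  have x2: "\<gamma> t $ 2 = null_curve t0 t $ 2" for t
  proof -
    have "E t0 = 1 / c"
      using c_E c_pos by (simp add: field_simps)
    then have "ln (y t) = ln (E (t - t0)) - ln (E t0)"
      using c_pos E_pos[of "t - t0"] by (simp add: y_E ln_mult ln_div)
    also have "\<dots> = ln ((2 - sqrt 2) * E (t - t0)) - ln ((2 - sqrt 2) * E t0)"
      using E_pos[of "t - t0"] E_pos[of t0] real_less_lsqrt[of 2 2] by (simp add: ln_mult)
    finally have "ln (y t) = ln ((2 - sqrt 2) * E (t - t0)) - ln ((2 - sqrt 2) * E t0)" .
    then show ?thesis
      by (simp add: y_def null_curve_def eval_between_def null_curve_denominator E_def)
  qed
  have x3: "\<gamma> t $ 3 = null_curve t0 t $ 3" for t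
  proof (rule eq_if_same_derivative[where a = 0 and f = "\<lambda>t. \<gamma> t $ 3"
        and g = "\<lambda>t. null_curve t0 t $ 3"
        and h = "\<lambda>t. sqrt 2 * E t0 * ((2 * cos (t - t0) + sqrt 2) / (E (t - t0))\<^sup>2)"])
    fix t
    have "y t - c = c * (1 + sqrt 2 * cos (t - t0))"
      by (simp add: y_E E_def algebra_simps)
    then have "v t $ 3 = 2 * (1 + sqrt 2 * cos (t - t0)) / (c * (E (t - t0))\<^sup>2)"
      unfolding v3 using c_pos E_pos[of "t - t0"]
      by (simp add: y_E power2_eq_square)
    also have "\<dots> = sqrt 2 * E t0 * ((2 * cos (t - t0) + sqrt 2) / (E (t - t0))\<^sup>2)"
    proof -
      have "1 / c = E t0" using c_E c_pos by (simp add: field_simps)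
      then show ?thesis
        by (simp add: field_simps flip: \<open>1 / c = E t0\<close>)
    qed
    finally show "((\<lambda>t. \<gamma> t $ 3) has_real_derivative
        sqrt 2 * E t0 * ((2 * cos (t - t0) + sqrt 2) / (E (t - t0))\<^sup>2)) (at t)"
      using d\<gamma>[where i = 3 and t = t] by simp
    have *: "((\<lambda>t. sin (t - t0) / E (t - t0)) has_real_derivative
        ((2 * cos (t - t0) + sqrt 2) / (E (t - t0))\<^sup>2) * 1) (at t)"
      unfolding E_def
      by (rule DERIV_chain2[OF null_curve_third_has_real_derivative])
        (auto intro!: derivative_eq_intros)
    \<comment> \<open>The lower limit -t0 contributes only a constant, so the derivative comes from
      the first summand.\<close>
    have "null_curve t0 t $ 3
        = sqrt 2 * E t0 * (sin (t - t0) / E (t - t0)) + sqrt 2 * E t0 * (sin t0 / E t0)" for t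
      using E_pos[of t0] E_pos[of "t - t0"] real_less_lsqrt[of 2 2]
      by (simp add: null_curve_def eval_between_def null_curve_denominator \<beta>\<^sub>2_def E_def)
    then show "((\<lambda>t. null_curve t0 t $ 3) has_real_derivative
        sqrt 2 * E t0 * ((2 * cos (t - t0) + sqrt 2) / (E (t - t0))\<^sup>2)) (at t)"
      using DERIV_add[OF DERIV_cmult[OF *] DERIV_const] by (simp only: mult_1_right add_0_right)
  qed (simp add: x0 null_curve_def eval_between_def)
  have "\<gamma> t = null_curve t0 t" for t
    using x1 x2 x3 by (simp add: vec_eq_iff forall_3)
  then show ?thesis by blast
qed

text \<open>The condition x_1'(0) = 0 only forces sin t0 = 0, which t0 = pi satisfies too; the
  special case therefore also fixes the parameter 0.\<close>

theorem theorem1: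
  fixes \<gamma> :: "real \<Rightarrow> real ^ 3"
  assumes "geodesic G0_metric \<gamma>"
    and "isotropic G0_metric \<gamma>"
    and "\<gamma> 0 = G0_unit"
    and "future_directed \<gamma>"
    and "normalized \<gamma>"
  shows "(\<exists>t0. \<forall>t. \<gamma> t = null_curve t0 t) \<and>
         (velocity \<gamma> 0 $ 2 = 0 \<and> (\<forall>t. \<gamma> t = null_curve 0 t) \<longrightarrow>
           (\<forall>t. \<gamma> t $ 1 = - t + 2 * sqrt 2 * arctan_tan (sqrt 2 - 1) (t / 2) \<and>
                \<gamma> t $ 2 = ln (((1 + \<alpha>\<^sub>2) + (1 - \<alpha>\<^sub>2) * cos t) / 2) \<and>
                \<gamma> t $ 3 = 2 * sqrt 2 * sin t / ((1 + \<alpha>\<^sub>2) + (1 - \<alpha>\<^sub>2) * cos t)))"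
proof (intro conjI impI allI)
  show "\<exists>t0. \<forall>t. \<gamma> t = null_curve t0 t"
    using assms(1-3,5) by (rule isotropic_geodesic_is_null_curve)
  assume *: "velocity \<gamma> 0 $ 2 = 0 \<and> (\<forall>t. \<gamma> t = null_curve 0 t)"
  fix t
  \<comment> \<open>Positivity allows the merging of ln D - ln 2 into ln (D / 2) for this
    denominator D. At the lower limit 0 the denominator is 2, which also gives
    \<open>\<beta>\<^sub>2\<close> the value 2 sqrt 2.\<close>
  have "(1 + \<alpha>\<^sub>2) + (1 - \<alpha>\<^sub>2) * cos t > 0"
    unfolding null_curve_denominator
    using two_plus_sqrt2_cos_pos[of t] real_less_lsqrt[of 2 2] by simp
  then show "\<gamma> t $ 1 = - t + 2 * sqrt 2 * arctan_tan (sqrt 2 - 1) (t / 2)"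
    and "\<gamma> t $ 2 = ln (((1 + \<alpha>\<^sub>2) + (1 - \<alpha>\<^sub>2) * cos t) / 2)"
    and "\<gamma> t $ 3 = 2 * sqrt 2 * sin t / ((1 + \<alpha>\<^sub>2) + (1 - \<alpha>\<^sub>2) * cos t)"
    using * by (simp_all add: null_curve_def eval_between_def \<beta>\<^sub>2_def arctan_tan_def ln_div)
qed

end
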